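(* Let $\hat{\mathcal{P}}$ be a finite protocol instance, $\mathsf{s}$ one of its sorts, and $\varphi$ a quantifier-free clause in which all constants of $\mathsf{s}$ appear identically. Write $\varphi=\varphi_{others}\vee\bigvee_{c\in\mathsf{s}}\varphi_{\mathsf{s}}(c)$, where $\varphi_{others}$ is the disjunction of the literals of $\varphi$ containing no constant of $\mathsf{s}$ (possibly $\bot$) and $\varphi_{\mathsf{s}}(c)$ is the disjunction of the literals of $\varphi$ containing the constant $c$, and let $\widehat{\varphi_{\mathsf{s}}}$ be the clause in a variable $V$ of sort $\mathsf{s}$ obtained by replacing $c$ by $V$ in $\varphi_{\mathsf{s}}(c)$ (the same clause for every $c\in\mathsf{s}$). Let $\Phi(\mathsf{s})=\varphi_{others}\vee\exists V\in\mathsf{s}:\ \widehat{\varphi_{\mathsf{s}}}$. Then $\Phi(\mathsf{s})$ is logically equivalent to $\varphi^{L(Sym(\mathsf{s}))}=\bigwedge_{\gamma\in Sym(\mathsf{s})}\varphi^{\gamma}$.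
   Context: A finite protocol instance has finitely many sorts, each a finite set of distinct constants; state variables are Boolean variables $r(c_1,\dots,c_k)$ obtained by instantiating protocol relations with sort constants, and a clause is a disjunction of literals over them. $Sym(\mathsf{s})$ is the symmetric group on the constants of sort $\mathsf{s}$; for $\gamma\in Sym(\mathsf{s})$, $\varphi^{\gamma}$ is obtained by replacing each constant $c$ of $\mathsf{s}$ in $\varphi$ by $\gamma(c)$. Two constants $c_i,c_j$ of $\mathsf{s}$ appear identically in $\varphi$ if both occur in $\varphi$ and swapping them yields a logically equivalent clause, $\varphi^{(c_i\ c_j)}\equiv\varphi$; "all constants of $\mathsf{s}$ appear identically in $\varphi$" means every constant of $\mathsf{s}$ occurs in $\varphi$ and every pair of them appears identically.
   Formalization: That replacing c by V gives the same clause for every c is assumed, as identical appearance does not imply it (e.g. r(a,b) ∨ r(b,a)); it is proved when the clause is not a tautology and each literal contains at most one constant of the sort. *)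

theory Defs
  imports "HOL-Combinatorics.Permutations"
begin

record ('s, 'c, 'r) protocol_instance =
  sorts :: "'s set"
  consts_of :: "'s \<Rightarrow> 'c set"
  rels :: "'r set"
  signature_of :: "'r \<Rightarrow> 's list"

definition finite_protocol_instance :: "('s, 'c, 'r) protocol_instance \<Rightarrow> bool" where
  "finite_protocol_instance P \<longleftrightarrow>
     finite (sorts P) \<and>
     (\<forall>s\<in>sorts P. finite (consts_of P s)) \<and>
     (\<forall>s\<in>sorts P. \<forall>s'\<in>sorts P. s \<noteq> s' \<longrightarrow> consts_of P s \<inter> consts_of P s' = {}) \<and>
     finite (rels P) \<and>
     (\<forall>r\<in>rels P. set (signature_of P r) \<subseteq> sorts P)"

text \<open>Literals over terms of type \<open>'t\<close>: with \<open>'t = 'c\<close> these are literals over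
  state variables, with \<open>'t = 'c trm\<close> they may contain the variable \<open>V\<close>.\<close>

datatype (lit_rels: 'r, lit_terms: 't) literal =
    Pos 'r "'t list"
  | Neg 'r "'t list"

datatype 'c trm = Cst 'c | V

text \<open>A clause is the disjunction of its literals; the empty clause is \<open>\<bottom>\<close>.\<close>

type_synonym ('r, 't) clause = "('r, 't) literal set"

definition state_var :: "('s, 'c, 'r) protocol_instance \<Rightarrow> 'r \<Rightarrow> 'c list \<Rightarrow> bool" where
  "state_var P r cs \<longleftrightarrow>
     r \<in> rels P \<and> list_all2 (\<lambda>c s. c \<in> consts_of P s) cs (signature_of P r)"

fun wf_literal :: "('s, 'c, 'r) protocol_instance \<Rightarrow> ('r, 'c) literal \<Rightarrow> bool" where
  "wf_literal P (Pos r cs) = state_var P r cs"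
| "wf_literal P (Neg r cs) = state_var P r cs"

definition wf_clause :: "('s, 'c, 'r) protocol_instance \<Rightarrow> ('r, 'c) clause \<Rightarrow> bool" where
  "wf_clause P \<phi> \<longleftrightarrow> finite \<phi> \<and> (\<forall>l\<in>\<phi>. wf_literal P l)"

definition clause_consts :: "('r, 'c) clause \<Rightarrow> 'c set" where
  "clause_consts \<phi> = (\<Union>l\<in>\<phi>. lit_terms l)"

definition rename :: "('t \<Rightarrow> 'u) \<Rightarrow> ('r, 't) clause \<Rightarrow> ('r, 'u) clause" where
  "rename f \<phi> = map_literal id f ` \<phi>"

text \<open>Quantified formulas: \<open>Ex s \<psi>\<close> is \<open>\<exists>V\<in>s. \<psi>\<close>, and \<open>Conj\<close> is the conjunction
  of a set of clauses.\<close>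

datatype ('s, 'c, 'r) formula =
    Clause "('r, 'c) clause"
  | Conj "('r, 'c) clause set"
  | Ex 's "('r, 'c trm) clause"
  | Or "('s, 'c, 'r) formula" "('s, 'c, 'r) formula"

text \<open>A state assigns a Boolean to every \<open>r(c\<^sub>1,\<dots>,c\<^sub>k)\<close>. It is also defined on
  ill-sorted argument lists, but no well-formed clause depends on those values.\<close>

type_synonym ('r, 'c) state = "'r \<Rightarrow> 'c list \<Rightarrow> bool"

fun sat_literal :: "('r, 'c) state \<Rightarrow> ('r, 'c) literal \<Rightarrow> bool" where
  "sat_literal M (Pos r cs) = M r cs"
| "sat_literal M (Neg r cs) = (\<not> M r cs)"

definition sat_clause :: "('r, 'c) state \<Rightarrow> ('r, 'c) clause \<Rightarrow> bool" where
  "sat_clause M \<phi> \<longleftrightarrow> (\<exists>l\<in>\<phi>. sat_literal M l)"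

fun subst_V :: "'c \<Rightarrow> 'c trm \<Rightarrow> 'c" where
  "subst_V d (Cst c) = c"
| "subst_V d V = d"

fun sat :: "('s, 'c, 'r) protocol_instance \<Rightarrow> ('r, 'c) state \<Rightarrow> ('s, 'c, 'r) formula \<Rightarrow> bool" where
  "sat P M (Clause \<phi>) = sat_clause M \<phi>"
| "sat P M (Conj \<Gamma>) = (\<forall>\<phi>\<in>\<Gamma>. sat_clause M \<phi>)"
| "sat P M (Ex s \<psi>) = (\<exists>d\<in>consts_of P s. sat_clause M (rename (subst_V d) \<psi>))"
| "sat P M (Or F G) = (sat P M F \<or> sat P M G)"

definition equivalent ::
  "('s, 'c, 'r) protocol_instance \<Rightarrow> ('s, 'c, 'r) formula \<Rightarrow> ('s, 'c, 'r) formula \<Rightarrow> bool" where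
  "equivalent P F G \<longleftrightarrow> (\<forall>M. sat P M F \<longleftrightarrow> sat P M G)"

definition Sym :: "('s, 'c, 'r) protocol_instance \<Rightarrow> 's \<Rightarrow> ('c \<Rightarrow> 'c) set" where
  "Sym P s = {\<gamma>. \<gamma> permutes consts_of P s}"

definition sym_orbit ::
  "('s, 'c, 'r) protocol_instance \<Rightarrow> 's \<Rightarrow> ('r, 'c) clause \<Rightarrow> ('s, 'c, 'r) formula" where
  "sym_orbit P s \<phi> = Conj ((\<lambda>\<gamma>. rename \<gamma> \<phi>) ` Sym P s)"

definition appear_identically ::
  "('s, 'c, 'r) protocol_instance \<Rightarrow> ('r, 'c) clause \<Rightarrow> 'c \<Rightarrow> 'c \<Rightarrow> bool" where
  "appear_identically P \<phi> c d \<longleftrightarrow>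
     c \<in> clause_consts \<phi> \<and> d \<in> clause_consts \<phi> \<and>
     equivalent P (Clause (rename (transpose c d) \<phi>)) (Clause \<phi>)"

definition all_appear_identically ::
  "('s, 'c, 'r) protocol_instance \<Rightarrow> 's \<Rightarrow> ('r, 'c) clause \<Rightarrow> bool" where
  "all_appear_identically P s \<phi> \<longleftrightarrow>
     consts_of P s \<subseteq> clause_consts \<phi> \<and>
     (\<forall>c\<in>consts_of P s. \<forall>d\<in>consts_of P s. appear_identically P \<phi> c d)"

definition others ::
  "('s, 'c, 'r) protocol_instance \<Rightarrow> 's \<Rightarrow> ('r, 'c) clause \<Rightarrow> ('r, 'c) clause" where
  "others P s \<phi> = {l\<in>\<phi>. lit_terms l \<inter> consts_of P s = {}}"

definition containing :: "'c \<Rightarrow> ('r, 'c) clause \<Rightarrow> ('r, 'c) clause" where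
  "containing c \<phi> = {l\<in>\<phi>. c \<in> lit_terms l}"

definition abstract :: "'c \<Rightarrow> ('r, 'c) clause \<Rightarrow> ('r, 'c trm) clause" where
  "abstract c \<psi> = rename (\<lambda>x. if x = c then V else Cst x) \<psi>"

text \<open>\<open>is_template P s \<phi> \<psi>\<close>: replacing \<open>c\<close> by \<open>V\<close> in the literals of \<open>\<phi>\<close> containing
  \<open>c\<close> gives the same clause \<open>\<psi>\<close> for every \<open>c\<close> of sort \<open>s\<close>. Identical appearance alone
  does not guarantee that such a \<open>\<psi>\<close> exists: it fails for \<open>r(a,b) \<or> r(b,a)\<close> and for the
  tautology \<open>r(a) \<or> \<not>r(a) \<or> r(b)\<close>, where \<open>a\<close>, \<open>b\<close> are the constants of \<open>s\<close>.\<close>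

definition is_template ::
  "('s, 'c, 'r) protocol_instance \<Rightarrow> 's \<Rightarrow> ('r, 'c) clause \<Rightarrow> ('r, 'c trm) clause \<Rightarrow> bool" where
  "is_template P s \<phi> \<psi> \<longleftrightarrow> (\<forall>c\<in>consts_of P s. abstract c (containing c \<phi>) = \<psi>)"

definition Phi ::
  "('s, 'c, 'r) protocol_instance \<Rightarrow> 's \<Rightarrow> ('r, 'c) clause \<Rightarrow> ('r, 'c trm) clause
    \<Rightarrow> ('s, 'c, 'r) formula" where
  "Phi P s \<phi> \<psi> = Or (Clause (others P s \<phi>)) (Ex s \<psi>)"

definition tautology :: "('r, 'c) clause \<Rightarrow> bool" where
  "tautology \<phi> \<longleftrightarrow> (\<forall>M. sat_clause M \<phi>)"

end

theory Submission
  imports Defs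
begin

text \<open>Semantically, renaming a clause amounts to pulling the state back along the renaming.
  Hence invariance of \<open>\<phi>\<close> under the transpositions of a sort extends to all its permutations,
  so the symmetry orbit is equivalent to \<open>\<phi>\<close>; and instantiating the template at \<open>d\<close> gives back
  the literals of \<open>\<phi>\<close> containing \<open>d\<close>, so \<open>\<Phi>(s)\<close> is equivalent to \<open>\<phi>\<close> as well.
  The template exists because equivalent non-tautological clauses have the same literals:
  swapping \<open>c\<close> and \<open>d\<close> then permutes the literals of \<open>\<phi>\<close> and carries those containing \<open>c\<close> to
  those containing \<open>d\<close>.\<close>

lemma rename_comp: "rename f (rename g \<phi>) = rename (f \<circ> g) \<phi>"
  by (simp add: rename_def image_image literal.map_comp)

lemma rename_cong:
  assumes "\<And>l x. l \<in> \<phi> \<Longrightarrow> x \<in> lit_terms l \<Longrightarrow> f x = g x"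
  shows "rename f \<phi> = rename g \<phi>"
  unfolding rename_def using assms by (intro image_cong literal.map_cong refl) auto

lemma rename_id: "rename id \<phi> = \<phi>"
  by (simp add: rename_def literal.map_id)

lemma sat_literal_map:
  "sat_literal M (map_literal id f l) \<longleftrightarrow> sat_literal (\<lambda>r cs. M r (map f cs)) l"
  by (cases l) auto

lemma sat_clause_rename:
  "sat_clause M (rename f \<phi>) \<longleftrightarrow> sat_clause (\<lambda>r cs. M r (map f cs)) \<phi>"
  by (simp add: sat_clause_def rename_def sat_literal_map)

text \<open>Permutations of a finite set are products of transpositions, removed here one at a time
  from the inside.\<close>

lemma sat_clause_rename_permutation:
  assumes "finite S" and "\<gamma> permutes S"
    and inv: "\<And>c d M. c \<in> S \<Longrightarrow> d \<in> S \<Longrightarrow>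
      sat_clause M (rename (transpose c d) \<phi>) \<longleftrightarrow> sat_clause M \<phi>"
  shows "sat_clause M (rename \<gamma> \<phi>) \<longleftrightarrow> sat_clause M \<phi>"
  using assms(1,2)
proof (induction arbitrary: M rule: permutes_rev_induct)
  case id
  show ?case by (simp only: rename_id)
next
  case (swap a b p)
  have "sat_clause M (rename (p \<circ> transpose a b) \<phi>)
      \<longleftrightarrow> sat_clause (\<lambda>r cs. M r (map p cs)) (rename (transpose a b) \<phi>)"
    by (simp add: rename_comp[symmetric] sat_clause_rename)
  \<comment> \<open>\<open>inv\<close> holds in every state, in particular in the one pulled back
    along \<open>p\<close>.\<close>
  also have "\<dots> \<longleftrightarrow> sat_clause (\<lambda>r cs. M r (map p cs)) \<phi>"
    using swap.hyps by (intro inv)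
  also have "\<dots> \<longleftrightarrow> sat_clause M (rename p \<phi>)"
    by (simp add: sat_clause_rename)
  also have "\<dots> \<longleftrightarrow> sat_clause M \<phi>"
    by (rule swap.IH)
  finally show ?case .
qed

lemma sat_sym_orbit:
  assumes "finite (consts_of P s)" and "all_appear_identically P s \<phi>"
  shows "sat P M (sym_orbit P s \<phi>) \<longleftrightarrow> sat_clause M \<phi>"
proof -
  have "sat_clause N (rename (transpose c d) \<phi>) \<longleftrightarrow> sat_clause N \<phi>"
    if "c \<in> consts_of P s" "d \<in> consts_of P s" for c d N
    using assms(2) that
    by (simp add: all_appear_identically_def appear_identically_def equivalent_def)
  then have "sat_clause M (rename \<gamma> \<phi>) \<longleftrightarrow> sat_clause M \<phi>" if "\<gamma> \<in> Sym P s" for \<gamma>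
    using that assms(1) sat_clause_rename_permutation[of "consts_of P s" \<gamma> \<phi> M]
    by (auto simp: Sym_def)
  \<comment> \<open>The identity makes \<open>\<phi>\<close> itself a conjunct, so the orbit implies
    \<open>\<phi>\<close>.\<close>
  moreover have "id \<in> Sym P s"
    unfolding Sym_def by (simp only: mem_Collect_eq permutes_id)
  ultimately show ?thesis
    using rename_id[of \<phi>] by (force simp: sym_orbit_def)
qed

text \<open>\<open>V\<close> arises only from \<open>c\<close>, every other constant being kept
  under \<open>Cst\<close>, so putting \<open>c\<close> back loses nothing.\<close>

lemma rename_subst_V_abstract: "rename (subst_V c) (abstract c \<phi>) = \<phi>"
proof -
  have "subst_V c \<circ> (\<lambda>x. if x = c then V else Cst x) = id"
    by auto
  then show ?thesis
    by (simp only: abstract_def rename_comp rename_id)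
qed

lemma clause_decomposition:
  "\<phi> = others P s \<phi> \<union> (\<Union>c\<in>consts_of P s. containing c \<phi>)"
  by (auto simp: others_def containing_def)

lemma sat_Phi:
  assumes "is_template P s \<phi> \<psi>"
  shows "sat P M (Phi P s \<phi> \<psi>) \<longleftrightarrow> sat_clause M \<phi>"
proof -
  have "rename (subst_V d) \<psi> = containing d \<phi>" if "d \<in> consts_of P s" for d
    using assms that rename_subst_V_abstract[of d "containing d \<phi>"]
    by (simp add: is_template_def)
  then have "sat P M (Phi P s \<phi> \<psi>) \<longleftrightarrow>
      sat_clause M (others P s \<phi> \<union> (\<Union>c\<in>consts_of P s. containing c \<phi>))"
    by (auto simp: Phi_def sat_clause_def)
  then show ?thesis
    using clause_decomposition[of \<phi> P s] by simp
qed

lemma subset_if_sat_clause_imp: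
  assumes "\<not> sat_clause M \<psi>"
    and imp: "\<And>M. sat_clause M \<phi> \<Longrightarrow> sat_clause M \<psi>"
  shows "\<phi> \<subseteq> \<psi>"
proof (rule subsetI, rule ccontr)
  fix l
  assume l: "l \<in> \<phi>" "l \<notin> \<psi>"
  \<comment> \<open>Making \<open>l\<close> true in a state refuting \<open>\<psi>\<close> could only newly satisfy \<open>l\<close> itself.\<close>
  define N where "N = (case l of Pos r cs \<Rightarrow> M(r := (M r)(cs := True))
    | Neg r cs \<Rightarrow> M(r := (M r)(cs := False)))"
  have "sat_literal N l"
    by (cases l) (auto simp: N_def)
  then have "sat_clause N \<psi>"
    using l by (intro imp) (auto simp: sat_clause_def)
  then obtain k where k: "k \<in> \<psi>" "sat_literal N k"
    by (auto simp: sat_clause_def)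
  \<comment> \<open>\<open>N\<close> differs from \<open>M\<close> at most at the state variable of
    \<open>l\<close>, and there the literal of opposite sign is false in \<open>N\<close>.\<close>
  have "k = l \<or> sat_literal M k"
    using k(2) by (cases l; cases k) (auto simp: N_def split: if_splits)
  then show False
    using k(1) l(2) assms(1) by (auto simp: sat_clause_def)
qed

lemma rename_eq_if_appear_identically:
  assumes "\<not> tautology \<phi>" and "appear_identically P \<phi> c d"
  shows "rename (transpose c d) \<phi> = \<phi>"
proof -
  have iff: "sat_clause M (rename (transpose c d) \<phi>) \<longleftrightarrow> sat_clause M \<phi>" for M
    using assms(2) by (simp add: appear_identically_def equivalent_def)
  obtain M where "\<not> sat_clause M \<phi>"
    using assms(1) by (auto simp: tautology_def)
  \<comment> \<open>By \<open>iff\<close>, the state \<open>M\<close> refutes both clauses, so the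
    inclusion of literals holds in both directions.\<close>
  then show ?thesis
    using iff by (intro equalityI subset_if_sat_clause_imp) auto
qed

lemma containing_rename_transpose:
  "containing d (rename (transpose c d) \<phi>) = rename (transpose c d) (containing c \<phi>)"
  by (auto simp: containing_def rename_def literal.set_map in_transpose_image_iff)

text \<open>In a literal with \<open>c\<close> but not \<open>d\<close>, swapping and then
  abstracting \<open>d\<close> turns \<open>c\<close> into \<open>V\<close> and fixes the rest.
  \<open>sep\<close> excludes literals such as \<open>r(c,d)\<close>, which would give
  \<open>r(V,c)\<close> instead of \<open>r(V,d)\<close>.\<close>

lemma abstract_containing_eq:
  assumes "rename (transpose c d) \<phi> = \<phi>"
    and sep: "\<And>l. l \<in> \<phi> \<Longrightarrow> c \<in> lit_terms l \<Longrightarrow> d \<in> lit_terms l \<Longrightarrow> c = d"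
  shows "abstract d (containing d \<phi>) = abstract c (containing c \<phi>)"
proof -
  have "abstract d (containing d \<phi>) = abstract d (rename (transpose c d) (containing c \<phi>))"
    using containing_rename_transpose[of d c \<phi>] assms(1) by simp
  also have "\<dots> = abstract c (containing c \<phi>)"
    unfolding abstract_def rename_comp
    using sep by (intro rename_cong) (auto simp: containing_def transpose_def)
  finally show ?thesis .
qed

lemma template_exists:
  assumes "\<not> tautology \<phi>" and "all_appear_identically P s \<phi>"
    and card: "\<And>l. l \<in> \<phi> \<Longrightarrow> card (lit_terms l \<inter> consts_of P s) \<le> 1"
  shows "\<exists>\<psi>. is_template P s \<phi> \<psi>"
proof (cases "consts_of P s = {}")
  case True
  then show ?thesis
    by (simp add: is_template_def)
next
  case False
  then obtain c where c: "c \<in> consts_of P s"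
    by blast
  have "abstract d (containing d \<phi>) = abstract c (containing c \<phi>)"
    if d: "d \<in> consts_of P s" for d
  proof (rule abstract_containing_eq)
    show "rename (transpose c d) \<phi> = \<phi>"
      using assms(1,2) c d rename_eq_if_appear_identically[of \<phi> P c d]
      by (simp add: all_appear_identically_def)
    fix l
    assume l: "l \<in> \<phi>" "c \<in> lit_terms l" "d \<in> lit_terms l"
    \<comment> \<open>Finiteness matters because \<open>card\<close> of an infinite set is 0, so the
      bound alone would not give uniqueness.\<close>
    have "finite (lit_terms l)"
      by (cases l) auto
    then show "c = d"
      using card[OF l(1)] l(2,3) c d by (auto simp: card_le_Suc0_iff_eq)
  qed
  then show ?thesis
    by (auto simp: is_template_def)
qed

theorem theorem3:
  fixes P :: "('s, 'c, 'r) protocol_instance"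
    and s :: 's
    and \<phi> :: "('r, 'c) clause"
  assumes "finite_protocol_instance P"
    and "s \<in> sorts P"
    and "wf_clause P \<phi>"
    and "all_appear_identically P s \<phi>"
  shows "(\<forall>\<psi>. is_template P s \<phi> \<psi> \<longrightarrow> equivalent P (Phi P s \<phi> \<psi>) (sym_orbit P s \<phi>))
    \<and> (\<not> tautology \<phi> \<and> (\<forall>l\<in>\<phi>. card (lit_terms l \<inter> consts_of P s) \<le> 1)
        \<longrightarrow> (\<exists>\<psi>. is_template P s \<phi> \<psi>))"
proof -
  have "finite (consts_of P s)"
    using assms(1,2) by (simp add: finite_protocol_instance_def)
  then show ?thesis
    using assms(4) by (auto simp: equivalent_def sat_Phi sat_sym_orbit intro: template_exists)
qed

end
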